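(* Let $N, A, B, a_1, a_2, b_1, b_2$ be positive integers with $a_1 < a_2$ and $b_1 < b_2$ such that $$N = A B = (A + a_1)(B - b_1) = (A + a_2)(B - b_2),$$ and suppose $B \le \sqrt{N} \le A$. Then $a_2$ is the largest among $a_1, a_2, b_1, b_2$, and $$A \le \frac{1}{4} a_2 (a_2 - 3)(a_2 + 1).$$ Moreover, equality $A = \frac{1}{4} a_2 (a_2 - 3)(a_2 + 1)$ holds if and only if $a_2 > 3$ is odd and $$A = \frac{a_2 (a_2 + 1)(a_2 - 3)}{4}, \quad B = \frac{(a_2 - 2)(a_2 - 1)^2}{4}, \quad a_1 = \frac{a_2 + 1}{2}, \quad b_1 = \frac{a_2 - 1}{2}, \quad b_2 = a_2 - 2.$$ Furthermore, the equality is attained: for every odd integer $a_2 > 3$, the integers $A, B, a_1, b_1, b_2$ given by these formulas, together with $N = AB$, satisfy all the hypotheses above. *)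

theory Defs
  imports Complex_Main
begin

text \<open>The variables range over the integers, so that \<open>B - b1\<close> and \<open>B - b2\<close> are genuine differences;
  positivity is required explicitly.\<close>

definition close_factorizations ::
    "int \<Rightarrow> int \<Rightarrow> int \<Rightarrow> int \<Rightarrow> int \<Rightarrow> int \<Rightarrow> int \<Rightarrow> bool" where
  "close_factorizations N A B a1 a2 b1 b2 \<longleftrightarrow>
     N > 0 \<and> A > 0 \<and> B > 0 \<and> a1 > 0 \<and> a2 > 0 \<and> b1 > 0 \<and> b2 > 0 \<and>
     a1 < a2 \<and> b1 < b2 \<and>
     N = A * B \<and> N = (A + a1) * (B - b1) \<and> N = (A + a2) * (B - b2) \<and>
     real_of_int B \<le> sqrt (real_of_int N) \<and> sqrt (real_of_int N) \<le> real_of_int A"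

text \<open>The quotients are taken in the reals, so each equation also asserts that its right-hand
  side is an integer.\<close>

definition extremal_values :: "int \<Rightarrow> int \<Rightarrow> int \<Rightarrow> int \<Rightarrow> int \<Rightarrow> int \<Rightarrow> bool" where
  "extremal_values A B a1 a2 b1 b2 \<longleftrightarrow>
     real_of_int A = real_of_int (a2 * (a2 + 1) * (a2 - 3)) / 4 \<and>
     real_of_int B = real_of_int ((a2 - 2) * (a2 - 1)^2) / 4 \<and>
     real_of_int a1 = real_of_int (a2 + 1) / 2 \<and>
     real_of_int b1 = real_of_int (a2 - 1) / 2 \<and>
     b2 = a2 - 2"

end

theory Submission
  imports Defs
begin

text \<open>Clearing \<open>A B\<close> from the factorizations gives \<open>a\<^sub>i B = b\<^sub>i (A + a\<^sub>i)\<close>. Hence \<open>b\<^sub>i < a\<^sub>i\<close>, because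
  \<open>B \<le> A\<close>, and eliminating \<open>B\<close> gives \<open>A D = a\<^sub>1 a\<^sub>2 (b\<^sub>2 - b\<^sub>1)\<close> with \<open>D = a\<^sub>2 b\<^sub>1 - a\<^sub>1 b\<^sub>2 \<ge> 1\<close>.
  Substituting \<open>x = a\<^sub>1\<close>, \<open>y = a\<^sub>2 - a\<^sub>1\<close>, \<open>k = a\<^sub>1 - b\<^sub>1 \<ge> 1\<close> and \<open>e = y - (b\<^sub>2 - b\<^sub>1)\<close> turns \<open>D\<close> into
  \<open>x e - k y\<close>, so that \<open>e \<ge> 1\<close>, and the bound becomes
  \<open>4 x (y - e) \<le> (x + y + 1) (x + y - 3) (x e - k y)\<close>. Even without the last factor the right side
  is strictly larger if \<open>e \<ge> 2\<close>, while for \<open>e = 1\<close> it exceeds the left side by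
  \<open>(x - y - 1) (x - y + 3)\<close>.\<close>

lemma extremal_inequality:
  fixes x y e k :: int
  assumes x: "x \<ge> 1" and e: "e \<ge> 1" and ye: "y > e" and k: "k \<ge> 1"
    and D: "x * e - k * y \<ge> 1"
  shows "4 * x * (y - e) \<le> (x + y + 1) * (x + y - 3) * (x * e - k * y)"
    and "4 * x * (y - e) = (x + y + 1) * (x + y - 3) * (x * e - k * y) \<Longrightarrow>
           e = 1 \<and> k = 1 \<and> x = y + 1"
proof -
  let ?F = "(x + y + 1) * (x + y - 3)"
  have "?F \<ge> 0"
    using x e ye by simp
  then have F: "?F \<le> ?F * (x * e - k * y)"
    using D mult_left_mono[of 1 "x * e - k * y" ?F] by simp
  have "4 * x * (y - e) \<le> ?F * (x * e - k * y) \<and>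
        (4 * x * (y - e) = ?F * (x * e - k * y) \<longrightarrow> e = 1 \<and> k = 1 \<and> x = y + 1)"
  proof (cases "e = 1")
    case True
    have "1 * y \<le> k * y"
      using k e ye by (intro mult_right_mono) auto
    then have xy: "x \<ge> y + 1"
      using D True by simp
    have diff: "?F = 4 * x * (y - e) + (x - y - 1) * (x - y + 3)"
      using True by (simp add: algebra_simps)
    \<comment> \<open>With \<open>e = 1\<close> and \<open>x = y + 1\<close>, the hypothesis
      \<open>D\<close> reads \<open>k * y \<le> y\<close>.\<close>
    have k1: "k = 1" if "x = y + 1"
    proof (rule ccontr)
      assume "k \<noteq> 1"
      then have "2 * y \<le> k * y"
        using k e ye by (intro mult_right_mono) auto
      then show False
        using D True that ye by simp
    qed
    show ?thesis
    proof (cases "x = y + 1")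
      case True
      then show ?thesis
        using F diff k1 \<open>e = 1\<close> by auto
    next
      case False
      then have "(x - y - 1) * (x - y + 3) > 0"
        using xy by (intro mult_pos_pos) auto
      then show ?thesis
        using F diff by linarith
    qed
  next
    case False
    then have e2: "e \<ge> 2"
      using e by simp
    then have "4 * x * (y - e) \<le> 4 * x * (y - 2)"
      using x by (intro mult_left_mono) auto
    moreover have "?F = 4 * x * (y - 2) + ((x - y + 3)\<^sup>2 + 4 * (y - 3))"
      by (simp add: algebra_simps power2_eq_square)
    \<comment> \<open>From \<open>y > e \<ge> 2\<close> comes \<open>y \<ge> 3\<close>. At
      \<open>y = 3\<close> the linear term vanishes and the square is that of \<open>x\<close>,
      which is positive.\<close>
    moreover have "(x - y + 3)\<^sup>2 + 4 * (y - 3) > 0"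
    proof (cases "y = 3")
      case True
      then show ?thesis using x by simp
    next
      case False
      then have "y - 3 > 0"
        using e2 ye by simp
      then show ?thesis
        by (intro add_nonneg_pos) auto
    qed
    ultimately show ?thesis
      using F by linarith
  qed
  then show "4 * x * (y - e) \<le> ?F * (x * e - k * y)"
    and "4 * x * (y - e) = ?F * (x * e - k * y) \<Longrightarrow> e = 1 \<and> k = 1 \<and> x = y + 1"
    by blast+
qed

text \<open>Expanding gives \<open>A * b + a * b = a * B\<close>, at most \<open>a * A\<close>; the
  positive cross term \<open>a * b\<close> makes \<open>A * b < A * a\<close> strict.\<close>

lemma cofactor_shift_less:
  fixes A B a b :: int
  assumes "A > 0" "b > 0" "a > 0" "B \<le> A" "A * B = (A + a) * (B - b)"
  shows "b < a"
proof -
  have "A * b + a * b = a * B"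
    using assms(5) by (simp add: algebra_simps)
  moreover have "a * B \<le> a * A"
    using assms by (intro mult_left_mono) auto
  moreover have "a * b > 0"
    using assms by simp
  ultimately have "A * b < A * a"
    by (simp add: mult.commute)
  then show ?thesis
    using assms(1) by simp
qed

text \<open>The bound is multiplied by 4 to stay in the integers. For the same reason the equality
  case is parametrized by \<open>b1\<close>, which equals half of \<open>a2 - 1\<close>
  there.\<close>

lemma close_factorizations_bounds:
  assumes "close_factorizations N A B a1 a2 b1 b2"
  shows "b1 < a1" and "b2 < a2"
    and "4 * A \<le> a2 * (a2 - 3) * (a2 + 1)"
    and "4 * A = a2 * (a2 - 3) * (a2 + 1) \<Longrightarrow>
           a2 = 2 * b1 + 1 \<and> a1 = b1 + 1 \<and> b2 = a2 - 2 \<and> B = (a2 - 2) * b1\<^sup>2"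
proof -
  have pos: "A > 0" "B > 0" "a1 > 0" "a2 > 0" "b1 > 0" "b2 > 0" and less: "a1 < a2" "b1 < b2"
    and eq1: "A * B = (A + a1) * (B - b1)" and eq2: "A * B = (A + a2) * (B - b2)"
    using assms unfolding close_factorizations_def by auto
  have "real_of_int B \<le> real_of_int A"
    using assms unfolding close_factorizations_def by (meson order_trans)
  then have "B \<le> A" by simp
  then show b1: "b1 < a1" and "b2 < a2"
    using cofactor_shift_less pos eq1 eq2 by blast+
  define k where "k = a1 - b1"
  define y where "y = a2 - a1"
  define e where "e = y - (b2 - b1)"
  define D where "D = a2 * b1 - a1 * b2"
  have D: "D = a1 * e - k * y"
    by (simp add: D_def k_def e_def y_def algebra_simps)
  have "a1 * B = b1 * (A + a1)" "a2 * B = b2 * (A + a2)"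
    using eq1 eq2 by algebra+
  \<comment> \<open>Cramer's rule: the equations \<open>ai * B - bi * A = ai * bi\<close> are linear
    in \<open>B\<close> and \<open>A\<close>, with determinant \<open>D\<close>.\<close>
  then have AD: "A * D = a1 * a2 * (b2 - b1)" and BD: "B * D = b1 * b2 * (a2 - a1)"
    unfolding D_def by algebra+
  have "A * D > 0"
    unfolding AD using pos less by simp
  then have D1: "D \<ge> 1"
    using pos by (simp add: zero_less_mult_iff)
  have k1: "k \<ge> 1" using b1 by (simp add: k_def)
  have "k * y > 0"
    using k1 less by (simp add: y_def)
  then have "a1 * e > 0"
    using D D1 by simp
  then have e1: "e \<ge> 1"
    using pos by (simp add: zero_less_mult_iff)
  have ye: "y > e" using less by (simp add: e_def)
  have a1: "a1 \<ge> 1" using pos by simp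
  note ineq = extremal_inequality[OF a1 e1 ye k1 D1[unfolded D]]
  \<comment> \<open>Since \<open>b2 - b1 = y - e\<close>, the left side of the inequality appears
    here; the positive factor \<open>D\<close> cancels at the end.\<close>
  have AD': "4 * A * D = a2 * (4 * a1 * (y - e))"
    using AD e_def by algebra
  have sum: "a1 + y = a2" by (simp add: y_def)
  have "4 * a1 * (y - e) \<le> (a2 + 1) * (a2 - 3) * D"
    using ineq(1) by (simp only: sum D)
  then have "4 * A * D \<le> a2 * ((a2 + 1) * (a2 - 3) * D)"
    unfolding AD' using pos by (intro mult_left_mono) auto
  also have "\<dots> = a2 * (a2 - 3) * (a2 + 1) * D"
    by (simp add: algebra_simps)
  finally show "4 * A \<le> a2 * (a2 - 3) * (a2 + 1)"
    using D1 by simp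
  assume "4 * A = a2 * (a2 - 3) * (a2 + 1)"
  then have "a2 * (4 * a1 * (y - e)) = a2 * ((a2 + 1) * (a2 - 3) * D)"
    using AD' by algebra
  then have "4 * a1 * (y - e) = (a2 + 1) * (a2 - 3) * D"
    using pos by simp
  then have eks: "e = 1 \<and> k = 1 \<and> a1 = y + 1"
    using ineq(2) by (simp only: sum D)
  then have a: "a1 = b1 + 1" "a2 = 2 * b1 + 1" "b2 = a2 - 2"
    by (auto simp: e_def k_def y_def)
  \<comment> \<open>Here \<open>D = a1 - y\<close>, so \<open>BD\<close> yields \<open>B\<close>
    itself, with \<open>a2 - a1 = b1\<close>.\<close>
  have "D = 1"
    using D eks by simp
  then have "B = (a2 - 2) * b1\<^sup>2"
    using BD a by algebra
  with a show "a2 = 2 * b1 + 1 \<and> a1 = b1 + 1 \<and> b2 = a2 - 2 \<and> B = (a2 - 2) * b1\<^sup>2"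
    by simp
qed

text \<open>Writing \<open>a2 = 2 * m + 1\<close> clears the denominators. The first shift trades
  the factor \<open>(2 * m + 1) * (m - 1)\<close> of \<open>A\<close> for the factor
  \<open>m * (2 * m - 1)\<close> of \<open>B\<close>, the second trades
  \<open>(m + 1) * (m - 1)\<close> for \<open>m\<^sup>2\<close>; in each pair the factors differ by
  1.\<close>

lemma close_factorizations_extremal:
  fixes m :: int
  assumes "m \<ge> 2"
  defines "A \<equiv> (2 * m + 1) * (m + 1) * (m - 1)" and "B \<equiv> (2 * m - 1) * m\<^sup>2"
  shows "extremal_values A B (m + 1) (2 * m + 1) m (2 * m - 1)"
    and "close_factorizations (A * B) A B (m + 1) (2 * m + 1) m (2 * m - 1)"
proof -
  show "extremal_values A B (m + 1) (2 * m + 1) m (2 * m - 1)"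
    by (simp add: extremal_values_def A_def B_def field_simps power2_eq_square)
  have pos: "A > 0" "B > 0"
    using assms by simp_all
  have "A - B = 2 * (m * (m - 2)) + (2 * m - 1)"
    by (simp add: A_def B_def algebra_simps power2_eq_square)
  moreover have "m * (m - 2) \<ge> 0"
    using assms by simp
  ultimately have BA: "B \<le> A"
    using assms by linarith
  have "(real_of_int B)\<^sup>2 \<le> real_of_int (A * B)" "real_of_int (A * B) \<le> (real_of_int A)\<^sup>2"
    using BA pos by (simp_all add: power2_eq_square)
  then have "real_of_int B \<le> sqrt (real_of_int (A * B))"
    "sqrt (real_of_int (A * B)) \<le> real_of_int A"
    using pos by (auto intro: real_le_rsqrt real_le_lsqrt)
  moreover have "A * B = (A + (m + 1)) * (B - m)"
    "A * B = (A + (2 * m + 1)) * (B - (2 * m - 1))"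
    unfolding A_def B_def by algebra+
  moreover have "A * B > 0" "m + 1 > 0" "2 * m + 1 > 0" "m > 0" "2 * m - 1 > 0"
    "m + 1 < 2 * m + 1" "m < 2 * m - 1"
    using pos assms(1) by simp_all
  ultimately show "close_factorizations (A * B) A B (m + 1) (2 * m + 1) m (2 * m - 1)"
    using pos unfolding close_factorizations_def by blast
qed

theorem theorem3:
  "(\<forall>N A B a1 a2 b1 b2 :: int. close_factorizations N A B a1 a2 b1 b2 \<longrightarrow>
      (a1 < a2 \<and> b1 < a2 \<and> b2 < a2) \<and>
      real_of_int A \<le> 1 / 4 * real_of_int (a2 * (a2 - 3) * (a2 + 1)) \<and>
      (real_of_int A = 1 / 4 * real_of_int (a2 * (a2 - 3) * (a2 + 1)) \<longleftrightarrow>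
        a2 > 3 \<and> odd a2 \<and> extremal_values A B a1 a2 b1 b2)) \<and>
   (\<forall>a2 :: int. odd a2 \<and> a2 > 3 \<longrightarrow>
      (\<exists>A B a1 b1 b2 :: int. extremal_values A B a1 a2 b1 b2 \<and>
        close_factorizations (A * B) A B a1 a2 b1 b2))"
proof (intro conjI allI impI)
  fix N A B a1 a2 b1 b2 :: int
  assume cf: "close_factorizations N A B a1 a2 b1 b2"
  note bounds = close_factorizations_bounds[OF cf]
  let ?P = "a2 * (a2 - 3) * (a2 + 1)"
  have pos: "A > 0" "a2 > 0"
    using cf by (simp_all add: close_factorizations_def)
  show "a1 < a2"
    using cf by (simp add: close_factorizations_def)
  then show "b1 < a2" "b2 < a2"
    using bounds(1,2) by simp_all
  have "real_of_int (4 * A) \<le> real_of_int ?P"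
    using bounds(3) by (simp only: of_int_le_iff)
  then show "real_of_int A \<le> 1 / 4 * real_of_int ?P"
    by simp
  \<comment> \<open>Positivity of \<open>A\<close> passes through the bound to \<open>?P\<close>,
    whose sign is that of \<open>a2 - 3\<close>.\<close>
  have "?P > 0" using bounds(3) pos by linarith
  then have "a2 > 3"
    using pos by (simp add: zero_less_mult_iff)
  show "real_of_int A = 1 / 4 * real_of_int ?P \<longleftrightarrow>
      a2 > 3 \<and> odd a2 \<and> extremal_values A B a1 a2 b1 b2"
  proof
    assume A: "real_of_int A = 1 / 4 * real_of_int ?P"
    then have "real_of_int (4 * A) = real_of_int ?P"
      by simp
    then have "4 * A = ?P"
      by (simp only: of_int_eq_iff)
    note v = bounds(4)[OF this]
    then have "odd a2" by simp
    moreover have "extremal_values A B a1 a2 b1 b2"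
    proof -
      \<comment> \<open>In terms of \<open>b1\<close> the quotient by 4 disappears, because
        \<open>a2 - 1 = 2 * b1\<close>.\<close>
      have "B = (2 * b1 - 1) * b1\<^sup>2"
        using v by simp
      then show ?thesis
        using A v by (simp add: extremal_values_def power2_eq_square mult_ac)
    qed
    ultimately show "a2 > 3 \<and> odd a2 \<and> extremal_values A B a1 a2 b1 b2"
      using \<open>a2 > 3\<close> by simp
  next
    assume "a2 > 3 \<and> odd a2 \<and> extremal_values A B a1 a2 b1 b2"
    then show "real_of_int A = 1 / 4 * real_of_int ?P"
      by (simp add: extremal_values_def)
  qed
next
  fix a2 :: int
  assume "odd a2 \<and> a2 > 3"
  moreover from this obtain m where "a2 = 2 * m + 1"
    by (auto elim: oddE)
  ultimately have "a2 = 2 * m + 1" "m \<ge> 2" by simp_all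
  then show "\<exists>A B a1 b1 b2 :: int. extremal_values A B a1 a2 b1 b2 \<and>
      close_factorizations (A * B) A B a1 a2 b1 b2"
    using close_factorizations_extremal[of m] by blast
qed

end
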